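(* 1. Suppose $\tau\in\mathbb{D}$ and consider the real-linear transformation of $\mathbb{C}$ to $\mathbb{C}$ given by $$z\mapsto\frac{z}{\sqrt{1-|\tau|^{2}}}+\frac{\tau}{\sqrt{1-|\tau|^{2}}}\bar{z},$$ which is represented by the matrix $A_\tau$ in $SL(2;\mathbb{R})$ given by $$A_{\tau}=\frac{1}{\sqrt{1-|\tau|^{2}}}\begin{pmatrix}1+\operatorname{Re}\tau & \operatorname{Im}\tau\\ \operatorname{Im}\tau & 1-\operatorname{Re}\tau\end{pmatrix}.$$ Then the sign of $V(A_\tau)$ can be chosen so that $V(A_\tau)=V_\tau$. 2. If $A=\begin{pmatrix}\cos\theta & -\sin\theta\\ \sin\theta & \cos\theta\end{pmatrix}$ is a rotation by angle $\theta$, then $V(A)$ acts by rotations, up to a phase factor. Specifically, $$(V(A)F)(z)=\pm e^{-i\theta/2}F(e^{-i\theta}z).$$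
   Context: $\mathbb{D}=\{\tau\in\mathbb{C}:|\tau|<1\}$; $\mathbb{C}$ is identified with $\mathbb{R}^2$. The Segal--Bargmann space $\mathcal{B}$ is the Hilbert space of entire functions $F$ with $\|F\|^2=\int_{\mathbb{C}}|F(z)|^2\frac{e^{-|z|^2}}{\pi}\,dz<\infty$, where $dz$ is two-dimensional Lebesgue measure. With $D=d/dz$, the heat operator is $e^{-\tau D^2/2}F(z)=\sum_{k=0}^\infty\frac{1}{k!}\left(-\frac{\tau}{2}\right)^kD^{2k}F(z)$, and for $\tau\in\mathbb{D}$, $$(V_{\tau}F)(z)=(1-|\tau|^{2})^{1/4}\,e^{\bar\tau z^{2}/2}\,(e^{-\tau D^{2}/2}F)\left(z\sqrt{1-|\tau|^{2}}\right).$$ Metaplectic operators: for $A=\begin{pmatrix}a&b\\c&d\end{pmatrix}\in SL(2;\mathbb{R})$ put $p=\frac{a-ib+ic+d}{2}$ and $q=\frac{a+ib+ic-d}{2}$ (so that $A$ acts on $\mathbb{C}\cong\mathbb{R}^2$ by $z\mapsto pz+q\bar z$, and $|p|^2-|q|^2=1$). The pair of operators $V(A)$, differing by a sign, is defined by $$[V(A)f](z)=\pm\frac{1}{\sqrt{p}}\int_{\mathbb{C}}\exp\left\{\frac12\frac{\bar q}{p}z^2-\frac12\frac{q}{p}\bar w^2+\frac1p z\bar w\right\}f(w)\frac{e^{-|w|^2}}{\pi}\,dw,$$ for $f\in\mathcal{B}$ (the $\pm$ means both choices of the square root of $p$ are allowed). *)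

theory Defs
  imports "HOL-Complex_Analysis.Complex_Analysis"
begin

definition segal_bargmann :: "(complex \<Rightarrow> complex) set" where
  "segal_bargmann =
     {F. F holomorphic_on UNIV \<and>
         integrable lborel (\<lambda>z. (cmod (F z))\<^sup>2 * (exp (- (cmod z)\<^sup>2) / pi))}"

definition heat_term :: "complex \<Rightarrow> (complex \<Rightarrow> complex) \<Rightarrow> complex \<Rightarrow> nat \<Rightarrow> complex" where
  "heat_term \<tau> F z k = 1 / fact k * (- \<tau> / 2) ^ k * (deriv ^^ (2 * k)) F z"

definition heat_op :: "complex \<Rightarrow> (complex \<Rightarrow> complex) \<Rightarrow> complex \<Rightarrow> complex" where
  "heat_op \<tau> F z = (\<Sum>k. heat_term \<tau> F z k)"

text \<open>An operator on the Segal--Bargmann space is an extensional function: it is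
  \<open>undefined\<close> outside that space, so that equality of operators means
  equality on the space.\<close>

definition V_disc :: "complex \<Rightarrow> (complex \<Rightarrow> complex) \<Rightarrow> (complex \<Rightarrow> complex)" where
  "V_disc \<tau> = (\<lambda>F\<in>segal_bargmann. \<lambda>z.
     of_real ((1 - (cmod \<tau>)\<^sup>2) powr (1/4)) * exp (cnj \<tau> * z\<^sup>2 / 2) *
     heat_op \<tau> F (z * of_real (sqrt (1 - (cmod \<tau>)\<^sup>2))))"

definition SL2R :: "(real^2^2) set" where
  "SL2R = {A. det A = 1}"

definition vec_of_complex :: "complex \<Rightarrow> real^2" where
  "vec_of_complex z = vector [Re z, Im z]"

definition p_coeff :: "real^2^2 \<Rightarrow> complex" where
  "p_coeff A = (of_real (A$1$1) - \<i> * of_real (A$1$2) + \<i> * of_real (A$2$1) + of_real (A$2$2)) / 2"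

definition q_coeff :: "real^2^2 \<Rightarrow> complex" where
  "q_coeff A = (of_real (A$1$1) + \<i> * of_real (A$1$2) + \<i> * of_real (A$2$1) - of_real (A$2$2)) / 2"

definition metaplectic_integrand ::
    "real^2^2 \<Rightarrow> (complex \<Rightarrow> complex) \<Rightarrow> complex \<Rightarrow> complex \<Rightarrow> complex" where
  "metaplectic_integrand A f z w =
     exp (1/2 * (cnj (q_coeff A) / p_coeff A) * z\<^sup>2 - 1/2 * (q_coeff A / p_coeff A) * (cnj w)\<^sup>2
          + 1 / p_coeff A * z * cnj w)
     * f w * of_real (exp (- (cmod w)\<^sup>2) / pi)"

text \<open>The pair of operators \<open>V(A)\<close> as a set, one element for each square root \<open>s\<close> of \<open>p\<close>.\<close>

definition metaplectic :: "real^2^2 \<Rightarrow> ((complex \<Rightarrow> complex) \<Rightarrow> (complex \<Rightarrow> complex)) set" where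
  "metaplectic A =
     {\<lambda>f\<in>segal_bargmann. \<lambda>z. 1 / s * (LINT w|lborel. metaplectic_integrand A f z w) | s.
        s\<^sup>2 = p_coeff A}"

definition A_disc :: "complex \<Rightarrow> real^2^2" where
  "A_disc \<tau> = (1 / sqrt (1 - (cmod \<tau>)\<^sup>2)) *\<^sub>R
     vector [vector [1 + Re \<tau>, Im \<tau>], vector [Im \<tau>, 1 - Re \<tau>]]"

definition rotation2 :: "real \<Rightarrow> real^2^2" where
  "rotation2 \<theta> = vector [vector [cos \<theta>, - sin \<theta>], vector [sin \<theta>, cos \<theta>]]"

end

theory Submission
  imports Defs "HOL-Probability.Distributions"
begin

text \<open>
  For \<open>F\<close> in the Segal--Bargmann space and the Gaussian measure \<open>\<mu>\<close>, rotation invariance of \<open>\<mu>\<close> makes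
  distinct monomials orthogonal on every disc around \<open>0\<close>; together with
  \<open>\<integral> \<bar>w\<bar>\<^sup>2\<^sup>n d\<mu> = n!\<close> this gives \<open>\<integral> (cnj w)\<^sup>n F(w) d\<mu> = F\<^sup>(\<^sup>n\<^sup>)(0)\<close>. Expanding the exponential turns this
  into the reproducing formula \<open>\<integral> (cnj w)\<^sup>n exp(\<zeta> cnj w) F(w) d\<mu> = F\<^sup>(\<^sup>n\<^sup>)(\<zeta>)\<close>, and expanding also
  \<open>exp(- \<tau> (cnj w)\<^sup>2 / 2)\<close> produces the heat series at \<open>\<zeta>\<close> term by term. All the exchanges of sum and
  integral are dominated by \<open>exp(a \<bar>w\<bar>\<^sup>2 / 2 + b \<bar>w\<bar>)\<close> with \<open>a < 1\<close>, which is square integrable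
  against \<open>\<mu>\<close>. Since \<open>q/p = \<tau>\<close> and \<open>1/p = sqrt (1 - \<bar>\<tau>\<bar>\<^sup>2)\<close> for \<open>A_disc \<tau>\<close>, and
  \<open>q = 0\<close>, \<open>p = exp(\<i>\<theta>)\<close> for a rotation, both parts are instances.
\<close>

subsection \<open>Rotation invariance of planar Lebesgue measure\<close>

text \<open>Both measures give a box the product of its side lengths, so \<open>lborel\<close> on
  the plane is the image of the product measure, and Tonelli applies in either order. Both orders
  are recorded because each kind of shear acts on a different coordinate.\<close>

lemma nn_integral_lborel_complex:
  assumes [measurable]: "f \<in> borel_measurable borel"
  shows "(\<integral>\<^sup>+w. f w \<partial>lborel) = (\<integral>\<^sup>+y. \<integral>\<^sup>+x. f (Complex x y) \<partial>lborel \<partial>lborel)"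
    and "(\<integral>\<^sup>+w. f w \<partial>lborel) = (\<integral>\<^sup>+x. \<integral>\<^sup>+y. f (Complex x y) \<partial>lborel \<partial>lborel)"
proof -
  let ?C = "\<lambda>(x, y). Complex x y"
  have meas[measurable]: "?C \<in> borel_measurable (borel \<Otimes>\<^sub>M borel)"
    by (simp add: Complex_eq case_prod_unfold)
  have lborel: "lborel = distr (lborel \<Otimes>\<^sub>M lborel) borel ?C"
  proof (rule lborel_eqI)
    fix l u :: complex
    assume lu: "\<And>b. b \<in> Basis \<Longrightarrow> l \<bullet> b \<le> u \<bullet> b"
    have le: "Re l \<le> Re u" "Im l \<le> Im u"
      using lu[of 1] lu[of \<i>] by (auto simp: Basis_complex_def)
    have "?C -` box l u \<inter> space (lborel \<Otimes>\<^sub>M lborel) = box (Re l) (Re u) \<times> box (Im l) (Im u)"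
      by (auto simp: in_box_complex_iff space_pair_measure)
    then have "emeasure (distr (lborel \<Otimes>\<^sub>M lborel) borel ?C) (box l u)
        = emeasure (lborel \<Otimes>\<^sub>M lborel) (box (Re l) (Re u) \<times> box (Im l) (Im u))"
      by (subst emeasure_distr) auto
    also have "\<dots> = ennreal (Re u - Re l) * ennreal (Im u - Im l)"
      using le by (subst lborel.emeasure_pair_measure_Times) auto
    also have "\<dots> = (\<Prod>b\<in>Basis. (u - l) \<bullet> b)"
      using le by (simp add: Basis_complex_def ennreal_mult')
    finally show "emeasure (distr (lborel \<Otimes>\<^sub>M lborel) borel ?C) (box l u) = (\<Prod>b\<in>Basis. (u - l) \<bullet> b)" .
  qed simp
  have eq: "(\<integral>\<^sup>+w. f w \<partial>lborel) = (\<integral>\<^sup>+p. f (?C p) \<partial>(lborel \<Otimes>\<^sub>M lborel))"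
    by (subst lborel) (simp add: nn_integral_distr)
  show "(\<integral>\<^sup>+w. f w \<partial>lborel) = (\<integral>\<^sup>+y. \<integral>\<^sup>+x. f (Complex x y) \<partial>lborel \<partial>lborel)"
    unfolding eq by (subst lborel_pair.nn_integral_snd[symmetric]) auto
  show "(\<integral>\<^sup>+w. f w \<partial>lborel) = (\<integral>\<^sup>+x. \<integral>\<^sup>+y. f (Complex x y) \<partial>lborel \<partial>lborel)"
    unfolding eq by (subst lborel.nn_integral_fst[symmetric]) auto
qed

text \<open>On each horizontal line the shear is a translation, which leaves the inner integral
  unchanged.\<close>

lemma nn_integral_shear_Re:
  fixes t :: real
  assumes [measurable]: "f \<in> borel_measurable borel"
  shows "(\<integral>\<^sup>+w. f (w + of_real (t * Im w)) \<partial>lborel) = (\<integral>\<^sup>+w. f w \<partial>lborel)"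
proof -
  have [measurable]: "(\<lambda>x. Complex x y) \<in> borel_measurable borel" for y
    by (simp add: Complex_eq)
  have "(\<integral>\<^sup>+x. f (Complex x y) \<partial>lborel) = (\<integral>\<^sup>+x. f (Complex x y + of_real (t * y)) \<partial>lborel)" for y
    using nn_integral_real_affine[of "\<lambda>x. f (Complex x y)" 1 "t * y"]
    by (simp add: Complex_eq algebra_simps)
  then show ?thesis
    by (simp add: nn_integral_lborel_complex(1))
qed

lemma nn_integral_shear_Im:
  fixes t :: real
  assumes [measurable]: "f \<in> borel_measurable borel"
  shows "(\<integral>\<^sup>+w. f (w + \<i> * of_real (t * Re w)) \<partial>lborel) = (\<integral>\<^sup>+w. f w \<partial>lborel)"
proof -
  have [measurable]: "(\<lambda>y. Complex x y) \<in> borel_measurable borel" for x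
    by (simp add: Complex_eq)
  have "(\<integral>\<^sup>+y. f (Complex x y) \<partial>lborel) = (\<integral>\<^sup>+y. f (Complex x y + \<i> * of_real (t * x)) \<partial>lborel)" for x
    using nn_integral_real_affine[of "\<lambda>y. f (Complex x y)" 1 "t * x"]
    by (simp add: Complex_eq algebra_simps)
  then show ?thesis
    by (simp add: nn_integral_lborel_complex(2))
qed

text \<open>A rotation through an angle not divisible by \<open>\<pi>\<close> is a product of three shears.\<close>

lemma nn_integral_rotate:
  assumes u: "cmod u = 1" and f[measurable]: "f \<in> borel_measurable borel"
  shows "(\<integral>\<^sup>+w. f (u * w) \<partial>lborel) = (\<integral>\<^sup>+w. f w \<partial>lborel)"
proof -
  have main: "(\<integral>\<^sup>+w. f (v * w) \<partial>lborel) = (\<integral>\<^sup>+w. f w \<partial>lborel)"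
    if v: "cmod v = 1" "Im v \<noteq> 0" and f[measurable]: "f \<in> borel_measurable borel" for v f
  proof -
    define s where "s = Im v"
    \<comment> \<open>For v = cis \<phi> this is -tan(\<phi>/2), the slope of the two outer shears;
      the middle one has slope s = sin \<phi>. The condition |v| = 1 enters through a(2 + as) =
      -s.\<close>
    define a where "a = (Re v - 1) / s"
    define X where "X = (\<lambda>w. w + of_real (a * Im w))"
    define Y where "Y = (\<lambda>w. w + \<i> * of_real (s * Re w))"
    have [measurable]: "X \<in> borel_measurable borel" "Y \<in> borel_measurable borel"
      by (simp_all add: X_def Y_def)
    have s0: "s \<noteq> 0" and c: "Re v = 1 + a * s" "s * (a * (2 + a * s)) = - s * s"
    proof -
      show "s \<noteq> 0" "Re v = 1 + a * s"
        using v by (simp_all add: s_def a_def)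
      then have "s * (a * (2 + a * s)) = (Re v)\<^sup>2 - 1"
        by (simp add: power2_eq_square algebra_simps)
      then show "s * (a * (2 + a * s)) = - s * s"
        using v cmod_power2[of v] by (simp add: s_def power2_eq_square)
    qed
    have as: "a * (2 + a * s) = - s"
      using c(2) s0 by (metis mult_cancel_left mult_minus_left mult_minus_right)
    have eq: "v * w = X (Y (X w))" for w
    proof (rule complex_eqI)
      have "Re (X (Y (X w))) = Re w * (1 + a * s) + Im w * (a * (2 + a * s))"
        by (simp add: X_def Y_def algebra_simps)
      then show "Re (v * w) = Re (X (Y (X w)))"
        by (simp add: as c(1) flip: s_def)
      show "Im (v * w) = Im (X (Y (X w)))"
        by (simp add: X_def Y_def c(1) algebra_simps flip: s_def)
    qed
    have "(\<integral>\<^sup>+w. f (X (Y (X w))) \<partial>lborel) = (\<integral>\<^sup>+w. f w \<partial>lborel)"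
      using nn_integral_shear_Re[of "\<lambda>w. f (X (Y w))" a] nn_integral_shear_Im[of "\<lambda>w. f (X w)" s]
        nn_integral_shear_Re[of f a] by (simp add: X_def Y_def)
    then show ?thesis
      by (simp add: eq)
  qed
  show ?thesis
  proof (cases "Im u = 0")
    case False
    then show ?thesis using main u f by blast
  next
    case True
    then have "u = 1 \<or> u = -1"
      using u by (auto simp: complex_eq_iff cmod_def abs_eq_iff)
    \<comment> \<open>The slope a divides by Im v, so the half turn is obtained as two quarter
      turns.\<close>
    moreover have "(\<integral>\<^sup>+w. f (- w) \<partial>lborel) = (\<integral>\<^sup>+w. f w \<partial>lborel)"
      using main[of \<i> "\<lambda>w. f (\<i> * w)"] main[of \<i> f] by (simp flip: mult.assoc)
    ultimately show ?thesis by auto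
  qed
qed

lemma lborel_rotate:
  assumes "cmod u = 1"
  shows "distr lborel lborel ((*) u) = lborel"
proof (rule measure_eqI)
  fix A assume "A \<in> sets (distr lborel lborel ((*) u))"
  then have [measurable]: "A \<in> sets borel" by simp
  have "emeasure (distr lborel lborel ((*) u)) A = (\<integral>\<^sup>+w. indicator A w \<partial>distr lborel lborel ((*) u))"
    by (subst nn_integral_indicator) auto
  also have "\<dots> = (\<integral>\<^sup>+w. indicator A (u * w) \<partial>lborel)"
    by (subst nn_integral_distr) auto
  also have "\<dots> = emeasure lborel A"
    by (subst nn_integral_rotate[OF assms]) auto
  finally show "emeasure (distr lborel lborel ((*) u)) A = emeasure lborel A" .
qed simp

lemma integral_rotate:
  fixes f :: "complex \<Rightarrow> 'b::{banach, second_countable_topology}"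
  assumes "cmod u = 1" and [measurable]: "f \<in> borel_measurable borel"
  shows "(LINT w|lborel. f (u * w)) = (LINT w|lborel. f w)"
  by (subst (2) lborel_rotate[OF assms(1), symmetric], subst integral_distr) auto

subsection \<open>Gaussian integrals\<close>

text \<open>The integrand factors over the two coordinates, and each factor is sqrt(pi/a) times a
  normal density of total mass 1.\<close>

lemma has_bochner_integral_gaussian:
  fixes a :: real
  assumes "a > 0"
  shows "has_bochner_integral lborel (\<lambda>w::complex. exp (- a * (cmod w)\<^sup>2) / pi) (1 / a)"
proof (rule has_bochner_integral_nn_integral)
  \<comment> \<open>This deviation turns the exponent x^2/(2\<sigma>^2) of the normal density into a
    x^2.\<close>
  define \<sigma> where "\<sigma> = 1 / sqrt (2 * a)"
  have \<sigma>: "\<sigma> > 0" "\<sigma>\<^sup>2 = 1 / (2 * a)"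
    using assms by (simp_all add: \<sigma>_def power_divide)
  have nd: "exp (- a * x\<^sup>2) = sqrt (pi / a) * normal_density 0 \<sigma> x" for x :: real
    using assms by (simp add: normal_density_def \<sigma> real_sqrt_divide)
  interpret prob_space "density lborel (normal_density 0 \<sigma>)"
    by (rule prob_space_normal_density[OF \<sigma>(1)])
  have "(\<integral>\<^sup>+x. normal_density 0 \<sigma> x \<partial>lborel) = 1"
    using emeasure_space_1 by (simp add: emeasure_density)
  then have one: "(\<integral>\<^sup>+x. exp (- a * x\<^sup>2) \<partial>lborel) = sqrt (pi / a)"
    using assms unfolding nd by (subst ennreal_mult) (auto simp: nn_integral_cmult)
  have "(\<integral>\<^sup>+w. ennreal (exp (- a * (cmod w)\<^sup>2) / pi) \<partial>lborel)
      = (\<integral>\<^sup>+w. ennreal (1 / pi) * (\<Prod>b\<in>Basis. ennreal (exp (- a * (w \<bullet> b)\<^sup>2))) \<partial>(lborel :: complex measure))"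
    by (intro nn_integral_cong)
      (simp add: Basis_complex_def cmod_power2 exp_add[symmetric] ennreal_mult[symmetric] algebra_simps)
  also have "\<dots> = ennreal (1 / pi) * (\<Prod>b\<in>(Basis :: complex set). sqrt (pi / a))"
    using assms by (subst nn_integral_cmult, simp, subst nn_integral_lborel_prod)
      (auto simp: one[simplified] ennreal_power)
  also have "\<dots> = ennreal (1 / a)"
    using assms by (simp add: Basis_complex_def ennreal_mult[symmetric])
  finally show "(\<integral>\<^sup>+w. ennreal (exp (- a * (cmod w)\<^sup>2) / pi) \<partial>lborel) = ennreal (1 / a)" .
qed (use assms in auto)

text \<open>The density of the probability measure \<mu> with respect to
  \<open>lborel\<close>.\<close>

definition gauss_weight :: "complex \<Rightarrow> real" where
  "gauss_weight w = exp (- (cmod w)\<^sup>2) / pi"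

lemma gauss_weight_nonneg [simp]: "gauss_weight w \<ge> 0"
  by (simp add: gauss_weight_def)

lemma borel_measurable_gauss_weight [measurable]: "gauss_weight \<in> borel_measurable borel"
  unfolding gauss_weight_def[abs_def] by measurable

lemma gauss_weight_rotate: "cmod u = 1 \<Longrightarrow> gauss_weight (u * w) = gauss_weight w"
  by (simp add: gauss_weight_def norm_mult)

section \<open>Growth bounds and termwise integration\<close>

lemma segal_bargmann_borel:
  assumes "F \<in> segal_bargmann"
  shows "F \<in> borel_measurable borel"
  using assms by (auto simp: segal_bargmann_def intro!: borel_measurable_continuous_onI holomorphic_on_imp_continuous_on)

text \<open>Lets the general results on integrals of G F against \<mu> be applied to G alone, with F
  = 1.\<close>

lemma one_in_segal_bargmann: "(\<lambda>_. 1) \<in> segal_bargmann"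
  using has_bochner_integral_gaussian[of 1] by (auto simp: segal_bargmann_def has_bochner_integral_iff)

text \<open>By |G F| \<le> |G|^2 + |F|^2 it is enough that |G|^2 is integrable against \<mu>. Its
  growth is at most exp(a|w|^2 + 2b|w|), which the weight beats because a < 1.\<close>

lemma integrable_growth_segal_bargmann:
  fixes G F :: "complex \<Rightarrow> complex"
  assumes F: "F \<in> segal_bargmann" and a: "a < 1"
    and G[measurable]: "G \<in> borel_measurable borel"
    and bound: "\<And>w. cmod (G w) \<le> C * exp (a / 2 * (cmod w)\<^sup>2 + b * cmod w)"
  shows "integrable lborel (\<lambda>w. G w * F w * of_real (gauss_weight w))"
proof -
  note [measurable] = segal_bargmann_borel[OF F]
  \<comment> \<open>The surplus of Gaussian decay. Half of it absorbs the linear term 2b|w|, at the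
    price of the constant in \<open>K\<close>; the other half gives integrability.\<close>
  define e where "e = 1 - a"
  have e: "e > 0" using a by (simp add: e_def)
  define K where "K = C\<^sup>2 * exp (2 * b\<^sup>2 / e)"
  have gauss: "integrable lborel (\<lambda>w::complex. exp (- (e / 2) * (cmod w)\<^sup>2) / pi)"
    using has_bochner_integral_gaussian[of "e / 2"] e by (auto simp: has_bochner_integral_iff)
  have sq: "integrable lborel (\<lambda>w. (cmod (F w))\<^sup>2 * gauss_weight w)"
    using F by (simp add: segal_bargmann_def gauss_weight_def)
  show ?thesis
  proof (rule Bochner_Integration.integrable_bound)
    show "integrable lborel (\<lambda>w. (cmod (F w))\<^sup>2 * gauss_weight w
            + K * (exp (- (e / 2) * (cmod w)\<^sup>2) / pi))"
      by (intro Bochner_Integration.integrable_add sq integrable_mult_right gauss)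
    have "cmod (G w * F w * of_real (gauss_weight w))
        \<le> (cmod (F w))\<^sup>2 * gauss_weight w + K * (exp (- (e / 2) * (cmod w)\<^sup>2) / pi)" for w
    proof -
      define x where "x = cmod w"
      \<comment> \<open>Completing the square, arranged so that exactly e x^2/2 is spent on
        2bx.\<close>
      have "0 \<le> (e * x - 2 * b)\<^sup>2 / (2 * e)"
        using e by simp
      also have "\<dots> = e * x\<^sup>2 / 2 - 2 * b * x + 2 * b\<^sup>2 / e"
        using e by (simp add: field_simps power2_eq_square)
      finally have bx: "2 * b * x \<le> e * x\<^sup>2 / 2 + 2 * b\<^sup>2 / e" by simp
      have "(cmod (G w))\<^sup>2 \<le> (C * exp (a / 2 * x\<^sup>2 + b * x))\<^sup>2"
        using bound[of w] unfolding x_def by (intro power_mono) auto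
      also have "\<dots> = C\<^sup>2 * exp (a * x\<^sup>2 + 2 * b * x)"
        by (simp add: power_mult_distrib exp_double[symmetric] algebra_simps)
      also have "\<dots> \<le> C\<^sup>2 * exp (2 * b\<^sup>2 / e + ((1 - e / 2) * x\<^sup>2))"
      proof -
        have "a * x\<^sup>2 = x\<^sup>2 - e * x\<^sup>2" "(1 - e / 2) * x\<^sup>2 = x\<^sup>2 - e * x\<^sup>2 / 2"
          by (simp_all add: e_def algebra_simps)
        then show ?thesis
          using bx by (intro mult_left_mono) auto
      qed
      also have "\<dots> = K * exp ((1 - e / 2) * x\<^sup>2)"
        by (simp add: K_def exp_add)
      finally have "(cmod (G w))\<^sup>2 * gauss_weight w \<le> K * exp ((1 - e / 2) * x\<^sup>2) * gauss_weight w"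
        by (rule mult_right_mono) simp
      also have "\<dots> = K * (exp (- (e / 2) * x\<^sup>2) / pi)"
        by (simp add: gauss_weight_def x_def exp_add[symmetric] algebra_simps)
      finally have G2: "(cmod (G w))\<^sup>2 * gauss_weight w \<le> K * (exp (- (e / 2) * x\<^sup>2) / pi)" .
      have "2 * (cmod (G w) * cmod (F w)) \<le> (cmod (G w))\<^sup>2 + (cmod (F w))\<^sup>2"
        using sum_squares_bound[of "cmod (G w)" "cmod (F w)"] by simp
      moreover have "0 \<le> cmod (G w) * cmod (F w)" by simp
      ultimately have "cmod (G w) * cmod (F w) \<le> (cmod (F w))\<^sup>2 + (cmod (G w))\<^sup>2"
        by linarith
      then have "cmod (G w) * cmod (F w) * gauss_weight w
          \<le> ((cmod (F w))\<^sup>2 + (cmod (G w))\<^sup>2) * gauss_weight w"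
        by (rule mult_right_mono) simp
      then show ?thesis
        using G2 by (simp add: norm_mult x_def ring_distribs)
    qed
    then show "AE w in lborel. cmod (G w * F w * of_real (gauss_weight w))
        \<le> norm ((cmod (F w))\<^sup>2 * gauss_weight w + K * (exp (- (e / 2) * (cmod w)\<^sup>2) / pi))"
      by (intro AE_I2) (metis abs_ge_self order_trans real_norm_def)
  qed measurable
qed

text \<open>Dominated convergence for the partial sums. The majorant is the growth bound times |F|
  and the weight, integrable by the preceding lemma. Every later exchange of sum and integral is an
  instance.\<close>

lemma segal_bargmann_integral_sums:
  fixes e :: "nat \<Rightarrow> complex \<Rightarrow> complex"
  assumes F: "F \<in> segal_bargmann" and a: "a < 1"
    and e[measurable]: "\<And>k. e k \<in> borel_measurable borel"
    and bound: "\<And>N w. (\<Sum>k<N. cmod (e k w)) \<le> C * exp (a / 2 * (cmod w)\<^sup>2 + b * cmod w)"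
    and sums: "\<And>w. (\<lambda>k. e k w) sums E w"
  shows "integrable lborel (\<lambda>w. E w * F w * of_real (gauss_weight w))"
    and "(\<lambda>k. LINT w|lborel. e k w * F w * of_real (gauss_weight w)) sums
           (LINT w|lborel. E w * F w * of_real (gauss_weight w))"
proof -
  note [measurable] = segal_bargmann_borel[OF F]
  have [measurable]: "E \<in> borel_measurable borel"
    by (rule borel_measurable_LIMSEQ_metric[of "\<lambda>N w. \<Sum>k<N. e k w"])
      (use sums in \<open>auto simp: sums_def\<close>)
  have int_e: "integrable lborel (\<lambda>w. e k w * F w * of_real (gauss_weight w))" for k
  proof (rule integrable_growth_segal_bargmann[OF F a])
    fix w
    have "cmod (e k w) \<le> (\<Sum>k<Suc k. cmod (e k w))"
      by (rule member_le_sum) auto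
    also note bound
    finally show "cmod (e k w) \<le> C * exp (a / 2 * (cmod w)\<^sup>2 + b * cmod w)" .
  qed simp
  define H where "H = (\<lambda>w. C * exp (a / 2 * (cmod w)\<^sup>2 + b * cmod w))"
  \<comment> \<open>The empty partial sum, N = 0, already forces the bound to be
    nonnegative.\<close>
  have H0: "H w \<ge> 0" for w
    using bound[of w 0] by (simp add: H_def)
  have int_H: "integrable lborel (\<lambda>w. H w * cmod (F w) * gauss_weight w)"
  proof -
    have "integrable lborel (\<lambda>w. of_real (H w) * F w * of_real (gauss_weight w))"
    proof (rule integrable_growth_segal_bargmann[OF F a])
      show "(\<lambda>w. complex_of_real (H w)) \<in> borel_measurable borel"
        unfolding H_def by measurable
      show "cmod (complex_of_real (H w)) \<le> C * exp (a / 2 * (cmod w)\<^sup>2 + b * cmod w)" for w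
        using H0[of w] by (simp only: norm_of_real abs_of_nonneg) (simp only: H_def order_refl)
    qed
    then have "integrable lborel (\<lambda>w. norm (of_real (H w) * F w * of_real (gauss_weight w)))"
      by (rule integrable_norm)
    then show ?thesis using H0 by (simp add: norm_mult)
  qed
  have conv: "(\<lambda>N. \<Sum>k<N. e k w * F w * of_real (gauss_weight w)) \<longlonglongrightarrow>
      E w * F w * of_real (gauss_weight w)" for w
    using sums_mult2[OF sums_mult2[OF sums[of w]]] by (simp add: sums_def)
  have dom: "cmod (\<Sum>k<N. e k w * F w * of_real (gauss_weight w)) \<le> H w * cmod (F w) * gauss_weight w" for N w
  proof -
    have "cmod (\<Sum>k<N. e k w * F w * of_real (gauss_weight w))
        = cmod (\<Sum>k<N. e k w) * cmod (F w) * gauss_weight w"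
      by (simp add: norm_mult flip: sum_distrib_right)
    also have "\<dots> \<le> H w * cmod (F w) * gauss_weight w"
      unfolding H_def by (intro mult_right_mono order_trans[OF norm_sum bound]) auto
    finally show ?thesis .
  qed
  show "integrable lborel (\<lambda>w. E w * F w * of_real (gauss_weight w))"
    by (rule integrable_dominated_convergence[where w = "\<lambda>w. H w * cmod (F w) * gauss_weight w"
      and s = "\<lambda>N w. \<Sum>k<N. e k w * F w * of_real (gauss_weight w)"])
      (use int_H conv dom in auto)
  have "(\<lambda>N. LINT w|lborel. (\<Sum>k<N. e k w * F w * of_real (gauss_weight w))) \<longlonglongrightarrow>
      (LINT w|lborel. E w * F w * of_real (gauss_weight w))"
    by (rule integral_dominated_convergence[where w = "\<lambda>w. H w * cmod (F w) * gauss_weight w"])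
      (use int_H conv dom in auto)
  then show "(\<lambda>k. LINT w|lborel. e k w * F w * of_real (gauss_weight w)) sums
           (LINT w|lborel. E w * F w * of_real (gauss_weight w))"
    unfolding sums_def by (subst (asm) Bochner_Integration.integral_sum[OF int_e])
qed

section \<open>Absolute moments of the Gaussian measure\<close>

lemma exp_sums: "(\<lambda>k. x ^ k / fact k) sums exp x"
  for x :: "'a::{real_normed_field, banach}"
  using exp_converges[of x] by (simp add: scaleR_conv_of_real divide_inverse mult.commute)

lemma exp_partial_sum_le:
  fixes x :: real
  assumes "x \<ge> 0"
  shows "(\<Sum>k<N. x ^ k / fact k) \<le> exp x"
  using sum_le_suminf[OF sums_summable[OF exp_sums], of "{..<N}" x] sums_unique[OF exp_sums[of x]] assms
  by simp

text \<open>Generating function: the integral of exp(t|w|^2) against \<mu> is 1/(1 - t), and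
  termwise it is the power series with coefficients \<open>M k / fact k\<close>. Comparison with the
  geometric series makes every coefficient 1.\<close>

lemma gaussian_absolute_moment:
  "(LINT w|lborel. cmod w ^ (2 * n) * gauss_weight w) = fact n"
proof -
  define M where "M k = (LINT w|lborel. cmod w ^ (2 * k) * gauss_weight w)" for k
  have sums: "(\<lambda>k. M k / fact k * t ^ k) sums (1 / (1 - t))" if t: "\<bar>t\<bar> < 1 / 2" for t :: real
  proof -
    define e where "e = (\<lambda>k w. complex_of_real ((t * (cmod w)\<^sup>2) ^ k / fact k))"
    have "(\<lambda>k. LINT w|lborel. e k w * 1 * of_real (gauss_weight w)) sums
           (LINT w|lborel. of_real (exp (t * (cmod w)\<^sup>2)) * 1 * of_real (gauss_weight w))"
    proof (rule segal_bargmann_integral_sums(2)[OF one_in_segal_bargmann])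
      \<comment> \<open>The majorant exp(|t||w|^2) has growth parameter a = 2|t|, whence the radius
        1/2. Any neighbourhood of 0 is enough to compare coefficients.\<close>
      show "2 * \<bar>t\<bar> < 1" using t by simp
      show "(\<Sum>k<N. cmod (e k w)) \<le> 1 * exp (2 * \<bar>t\<bar> / 2 * (cmod w)\<^sup>2 + 0 * cmod w)" for N w
        using exp_partial_sum_le[of "\<bar>t\<bar> * (cmod w)\<^sup>2" N]
        by (simp add: e_def norm_divide norm_mult norm_power power_mult_distrib)
      show "(\<lambda>k. e k w) sums complex_of_real (exp (t * (cmod w)\<^sup>2))" for w
        unfolding e_def sums_of_real_iff by (rule exp_sums)
    qed (simp add: e_def)
    moreover have "(LINT w|lborel. e k w * 1 * of_real (gauss_weight w)) = of_real (M k / fact k * t ^ k)" for k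
    proof -
      have "(LINT w|lborel. e k w * 1 * of_real (gauss_weight w))
          = (LINT w|lborel. complex_of_real (t ^ k / fact k * (cmod w ^ (2 * k) * gauss_weight w)))"
        by (simp add: e_def power_mult_distrib mult_ac flip: power_mult)
      also have "\<dots> = of_real (t ^ k / fact k * M k)"
        by (simp only: integral_complex_of_real integral_mult_right_zero M_def)
      finally show ?thesis by (simp add: mult_ac)
    qed
    moreover have "(LINT w|lborel. of_real (exp (t * (cmod w)\<^sup>2)) * 1 * of_real (gauss_weight w))
        = complex_of_real (1 / (1 - t))"
    proof -
      have "(LINT w|lborel. complex_of_real (exp (t * (cmod w)\<^sup>2)) * 1 * of_real (gauss_weight w))
          = (LINT w|lborel. complex_of_real (exp (- (1 - t) * (cmod w)\<^sup>2) / pi))"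
      proof (rule Bochner_Integration.integral_cong)
        fix w
        have "exp (t * (cmod w)\<^sup>2) * gauss_weight w = exp (- (1 - t) * (cmod w)\<^sup>2) / pi"
          by (simp add: gauss_weight_def exp_add[symmetric] algebra_simps)
        then show "complex_of_real (exp (t * (cmod w)\<^sup>2)) * 1 * of_real (gauss_weight w)
            = of_real (exp (- (1 - t) * (cmod w)\<^sup>2) / pi)"
          by (metis mult.right_neutral of_real_mult)
      qed simp
      also have "\<dots> = complex_of_real (1 / (1 - t))"
        using has_bochner_integral_gaussian[of "1 - t"] t
        by (simp only: integral_complex_of_real has_bochner_integral_iff)
      finally show ?thesis .
    qed
    ultimately show ?thesis
      by (simp only: sums_of_real_iff)
  qed
  have zero: "(\<lambda>k. (M k / fact k - 1) * t ^ k) sums 0" if t: "\<bar>t\<bar> < 1 / 2" for t :: real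
    using sums_diff[OF sums[OF t] geometric_sums[of t]] t by (simp add: algebra_simps)
  have "M 0 = 1"
    using zero[of 0] by simp
  moreover have "M n / fact n - 1 = 0" if "n > 0"
  proof (rule ccontr)
    assume neq: "M n / fact n - 1 \<noteq> 0"
    \<comment> \<open>A power series with a nonzero coefficient of positive degree has no further
      zeros close to 0. Here its sum is the zero function, so the conclusion reads 0 \<noteq> 0 on a
      punctured ball.\<close>
    obtain s where s: "0 < s" "\<And>z. z \<in> cball (0::real) s - {0} \<Longrightarrow> (0::real) \<noteq> 0"
      by (rule powser_0_nonzero[where r = "1 / 2" and \<xi> = 0 and f = "\<lambda>_. 0"
            and a = "\<lambda>k. M k / fact k - 1" and m = n])
        (use zero neq \<open>n > 0\<close> in auto)
    have "s \<in> cball 0 s - {0}"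
      using s(1) by simp
    with s(2) show False by blast
  qed
  ultimately have "M n = fact n"
    by (cases "n = 0") simp_all
  then show ?thesis
    by (simp only: M_def)
qed

subsection \<open>The reproducing formula\<close>

lemma borel_measurable_cnj [measurable]: "cnj \<in> borel_measurable borel"
  by (intro borel_measurable_continuous_onI continuous_intros)

text \<open>A suitable rotation preserves the disc and the weight but changes the sign of the
  monomial factor.\<close>

lemma integral_monomial_zero:
  assumes "k \<noteq> n"
  shows "(LINT w|lborel. indicator (ball 0 R) w * (cnj w ^ n * w ^ k * of_real (gauss_weight w))) = 0"
    (is "?I = 0")
proof -
  \<comment> \<open>The angle is chosen so that k - n times it equals pi, whichever of k and n is
    larger.\<close>
  define u where "u = cis (pi / (real k - real n))"
  have u: "cmod u = 1" by (simp add: u_def)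
  have [measurable]: "ball (0::complex) R \<in> sets borel" by simp
  have "u ^ k * cnj u ^ n = cis (real k * (pi / (real k - real n)) + real n * - (pi / (real k - real n)))"
    by (simp only: u_def cis_cnj Complex.DeMoivre cis_mult)
  also have "real k * (pi / (real k - real n)) + real n * - (pi / (real k - real n)) = pi"
    using assms by (simp flip: left_diff_distrib diff_divide_distrib)
  finally have uk: "u ^ k * cnj u ^ n = -1"
    by simp
  have "?I = (LINT w|lborel. indicator (ball 0 R) (u * w) *
      (cnj (u * w) ^ n * (u * w) ^ k * of_real (gauss_weight (u * w))))"
    using u by (subst integral_rotate) auto
  also have "\<dots> = (LINT w|lborel. (u ^ k * cnj u ^ n) *
      (indicator (ball 0 R) w * (cnj w ^ n * w ^ k * of_real (gauss_weight w))))"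
    using u by (intro Bochner_Integration.integral_cong)
      (auto simp: gauss_weight_rotate power_mult_distrib norm_mult indicator_def)
  also have "\<dots> = - ?I"
    by (simp add: uk)
  finally show ?thesis
    by simp
qed

text \<open>Integrate the Taylor series of F term by term; orthogonality leaves only degree n. On a
  disc the series has a constant majorant, while on the whole plane the absolute Taylor series need
  not satisfy a growth bound with a < 1.\<close>

lemma integral_ball_moment:
  assumes F: "F holomorphic_on UNIV" and R: "R > 0"
  shows "(LINT w|lborel. indicator (ball 0 R) w * (cnj w ^ n * F w * of_real (gauss_weight w)))
      = (deriv ^^ n) F 0 / fact n *
        (LINT w|lborel. indicator (ball 0 R) w * (cnj w ^ n * w ^ n * of_real (gauss_weight w)))"
proof -
  define a where "a k = (deriv ^^ k) F 0 / fact k" for k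
  have sums: "(\<lambda>k. a k * w ^ k) sums F w" for w
    using holomorphic_power_series[of F 0 "cmod w + 1" w] holomorphic_on_subset[OF F]
    by (simp add: a_def)
  \<comment> \<open>Convergence at the larger radius R + 1 yields absolute convergence at R.\<close>
  have "summable (\<lambda>k. a k * of_real (R + 1) ^ k)"
    using sums sums_summable by blast
  then have "summable (\<lambda>k. cmod (a k * of_real R ^ k))"
    by (rule powser_insidea) (use R in \<open>simp del: of_real_add\<close>)
  then have summ: "summable (\<lambda>k. cmod (a k) * R ^ k)"
    using R by (simp add: norm_mult norm_power)
  define I where "I k = (LINT w|lborel. indicator (ball 0 R) w * (cnj w ^ n * w ^ k * of_real (gauss_weight w)))" for k
  have [measurable]: "ball (0::complex) R \<in> sets borel" by simp
  define e where "e k w = indicator (ball 0 R) w * (cnj w ^ n * (a k * w ^ k))" for k w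
  have "(\<lambda>k. LINT w|lborel. e k w * 1 * of_real (gauss_weight w)) sums
      (LINT w|lborel. (indicator (ball 0 R) w * (cnj w ^ n * F w)) * 1 * of_real (gauss_weight w))"
  proof (rule segal_bargmann_integral_sums(2)[OF one_in_segal_bargmann])
    show "(\<Sum>k<N. cmod (e k w))
        \<le> (R ^ n * (\<Sum>k. cmod (a k) * R ^ k)) * exp (0 / 2 * (cmod w)\<^sup>2 + 0 * cmod w)" for N w
    proof -
      have "cmod (e k w) \<le> R ^ n * (cmod (a k) * R ^ k)" for k
      proof (cases "w \<in> ball 0 R")
        case True
        with R show ?thesis
          by (auto simp: e_def norm_mult norm_power intro!: mult_mono power_mono)
      next
        case False
        then show ?thesis using R by (simp add: e_def)
      qed
      then have "(\<Sum>k<N. cmod (e k w)) \<le> (\<Sum>k<N. R ^ n * (cmod (a k) * R ^ k))"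
        by (rule sum_mono)
      also have "\<dots> = R ^ n * (\<Sum>k<N. cmod (a k) * R ^ k)"
        by (simp add: sum_distrib_left)
      also have "\<dots> \<le> R ^ n * (\<Sum>k. cmod (a k) * R ^ k)"
        using R by (intro mult_left_mono sum_le_suminf summ) auto
      finally show ?thesis by simp
    qed
    show "(\<lambda>k. e k w) sums (indicator (ball 0 R) w * (cnj w ^ n * F w))" for w
      unfolding e_def by (intro sums_mult sums)
  qed (auto simp: e_def[abs_def])
  also have "(\<lambda>k. LINT w|lborel. e k w * 1 * of_real (gauss_weight w)) = (\<lambda>k. if k = n then a k * I k else 0)"
  proof
    fix k
    have "(LINT w|lborel. e k w * 1 * of_real (gauss_weight w))
        = (LINT w|lborel. a k * (indicator (ball 0 R) w * (cnj w ^ n * w ^ k * of_real (gauss_weight w))))"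
      by (simp add: e_def mult_ac)
    also have "\<dots> = a k * I k"
      by (simp add: I_def)
    also have "\<dots> = (if k = n then a k * I k else 0)"
      using integral_monomial_zero[of k n R] by (simp add: I_def)
    finally show "(LINT w|lborel. e k w * 1 * of_real (gauss_weight w)) = (if k = n then a k * I k else 0)" .
  qed
  finally have "(LINT w|lborel. (indicator (ball 0 R) w * (cnj w ^ n * F w)) * 1 * of_real (gauss_weight w)) = a n * I n"
    using sums_single[of n "\<lambda>k. a k * I k"] sums_unique2 by blast
  then show ?thesis
    by (simp add: a_def I_def mult.assoc)
qed

text \<open>Removes the cutoff to discs, by dominated convergence with majorant |f|.\<close>

lemma LIMSEQ_integral_ball:
  fixes f :: "complex \<Rightarrow> complex"
  assumes "integrable lborel f"
  shows "(\<lambda>N. LINT w|lborel. indicator (ball 0 (real N)) w * f w) \<longlonglongrightarrow> (LINT w|lborel. f w)"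
proof (rule integral_dominated_convergence[where w = "\<lambda>w. cmod (f w)"])
  have [measurable]: "f \<in> borel_measurable borel" "ball (0::complex) (real N) \<in> sets borel" for N
    using borel_measurable_integrable[OF assms] by simp_all
  show "f \<in> borel_measurable lborel" by measurable
  show "(\<lambda>w. indicator (ball 0 (real N)) w * f w) \<in> borel_measurable lborel" for N by measurable
  show "integrable lborel (\<lambda>w. cmod (f w))" using assms by (rule integrable_norm)
  show "AE w in lborel. cmod (indicator (ball 0 (real N)) w * f w) \<le> cmod (f w)" for N
    by (auto simp: indicator_def)
  have "(\<lambda>N. indicator (ball 0 (real N)) w * f w) \<longlonglongrightarrow> f w" for w
  proof (rule tendsto_eventually)
    have "\<forall>\<^sub>F N in sequentially. real N > cmod w"
      using filterlim_real_sequentially by (auto simp: filterlim_at_top_dense)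
    then show "\<forall>\<^sub>F N in sequentially. indicator (ball 0 (real N)) w * f w = f w"
      by eventually_elim simp
  qed
  then show "AE w in lborel. (\<lambda>N. indicator (ball 0 (real N)) w * f w) \<longlonglongrightarrow> f w"
    by simp
qed

text \<open>A single term of the exponential series. It brings powers of |w| under the growth bound
  with b = 1.\<close>

lemma power_le_fact_exp:
  fixes x :: real
  assumes "x \<ge> 0"
  shows "x ^ n \<le> fact n * exp x"
proof -
  have "x ^ n / fact n \<le> (\<Sum>k<Suc n. x ^ k / fact k)"
    using assms by (intro member_le_sum) auto
  also have "\<dots> \<le> exp x"
    using assms by (rule exp_partial_sum_le)
  finally show ?thesis
    by (simp add: field_simps)
qed

text \<open>Let the radius of the disc identity tend to infinity: the remaining integral of |w|^(2n)
  tends to n!, cancelling the factorial of the Taylor coefficient.\<close>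

lemma segal_bargmann_moment:
  assumes F: "F \<in> segal_bargmann"
  shows "(LINT w|lborel. cnj w ^ n * F w * of_real (gauss_weight w)) = (deriv ^^ n) F 0"
proof -
  have hol: "F holomorphic_on UNIV" using F by (simp add: segal_bargmann_def)
  let ?J = "\<lambda>N. LINT w|lborel. indicator (ball 0 (real N)) w * (cnj w ^ n * w ^ n * of_real (gauss_weight w))"
  have [measurable]: "(\<lambda>w. cnj w ^ n) \<in> borel_measurable borel" by measurable
  have bound: "cmod (cnj w ^ m) \<le> fact m * exp (0 / 2 * (cmod w)\<^sup>2 + 1 * cmod w)" for w m
    using power_le_fact_exp[of "cmod w" m] by (simp add: norm_power)
  have "(\<lambda>N. LINT w|lborel. indicator (ball 0 (real N)) w * (cnj w ^ n * F w * of_real (gauss_weight w)))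
      \<longlonglongrightarrow> (LINT w|lborel. cnj w ^ n * F w * of_real (gauss_weight w))"
    by (intro LIMSEQ_integral_ball integrable_growth_segal_bargmann[OF F _ _ bound]) auto
  \<comment> \<open>The disc identity requires a positive radius, so the two sequences agree only
    eventually.\<close>
  then have lim1: "(\<lambda>N. (deriv ^^ n) F 0 / fact n * ?J N)
      \<longlonglongrightarrow> (LINT w|lborel. cnj w ^ n * F w * of_real (gauss_weight w))"
    by (rule Lim_transform_eventually)
      (use eventually_gt_at_top[of 0] in eventually_elim, simp add: integral_ball_moment[OF hol])
  have sq: "cnj w ^ n * w ^ n * of_real (gauss_weight w) = of_real (cmod w ^ (2 * n) * gauss_weight w)" for w
  proof -
    have "cnj w ^ n * w ^ n = (w * cnj w) ^ n"
      by (simp add: power_mult_distrib)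
    also have "\<dots> = of_real (cmod w ^ (2 * n))"
      by (simp only: complex_norm_square[symmetric] power_mult of_real_power)
    finally show ?thesis by simp
  qed
  have "integrable lborel (\<lambda>w. (cnj w ^ n * w ^ n) * 1 * of_real (gauss_weight w))"
  proof (rule integrable_growth_segal_bargmann[OF one_in_segal_bargmann])
    show "cmod (cnj w ^ n * w ^ n) \<le> fact (2 * n) * exp (0 / 2 * (cmod w)\<^sup>2 + 1 * cmod w)" for w
      using power_le_fact_exp[of "cmod w" "2 * n"] by (simp add: norm_mult norm_power mult_2 power_add)
  qed auto
  then have "?J \<longlonglongrightarrow> (LINT w|lborel. cnj w ^ n * w ^ n * of_real (gauss_weight w))"
    by (intro LIMSEQ_integral_ball) simp
  also have "(LINT w|lborel. cnj w ^ n * w ^ n * of_real (gauss_weight w)) = fact n"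
    unfolding sq integral_complex_of_real gaussian_absolute_moment by simp
  finally have "(\<lambda>N. (deriv ^^ n) F 0 / fact n * ?J N) \<longlonglongrightarrow> (deriv ^^ n) F 0 / fact n * fact n"
    by (rule tendsto_mult_left)
  from LIMSEQ_unique[OF lim1 this] show ?thesis
    by simp
qed

text \<open>Expanding exp(\<zeta> cnj w) produces the moments of order j + n, which are the
  derivatives at 0 of the n-th derivative of F. Their Taylor series sums to its value at
  \<zeta>.\<close>

lemma segal_bargmann_reproducing:
  assumes F: "F \<in> segal_bargmann"
  shows "(LINT w|lborel. cnj w ^ n * exp (\<zeta> * cnj w) * F w * of_real (gauss_weight w)) = (deriv ^^ n) F \<zeta>"
proof -
  have hol: "F holomorphic_on UNIV" using F by (simp add: segal_bargmann_def)
  define e where "e j w = cnj w ^ n * ((\<zeta> * cnj w) ^ j / fact j)" for j w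
  have "(\<lambda>j. LINT w|lborel. e j w * F w * of_real (gauss_weight w)) sums
      (LINT w|lborel. cnj w ^ n * exp (\<zeta> * cnj w) * F w * of_real (gauss_weight w))"
  proof (rule segal_bargmann_integral_sums(2)[OF F])
    show "(\<Sum>j<N. cmod (e j w)) \<le> fact n * exp (0 / 2 * (cmod w)\<^sup>2 + (1 + cmod \<zeta>) * cmod w)" for N w
    proof -
      have "(\<Sum>j<N. cmod (e j w)) = cmod w ^ n * (\<Sum>j<N. (cmod \<zeta> * cmod w) ^ j / fact j)"
        by (simp add: e_def norm_mult norm_power norm_divide sum_distrib_left)
      also have "\<dots> \<le> (fact n * exp (cmod w)) * exp (cmod \<zeta> * cmod w)"
        by (intro mult_mono power_le_fact_exp exp_partial_sum_le sum_nonneg) auto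
      also have "\<dots> = fact n * exp (0 / 2 * (cmod w)\<^sup>2 + (1 + cmod \<zeta>) * cmod w)"
        by (simp add: exp_add ring_distribs)
      finally show ?thesis .
    qed
    show "(\<lambda>j. e j w) sums (cnj w ^ n * exp (\<zeta> * cnj w))" for w
      unfolding e_def by (rule sums_mult[OF exp_sums])
  qed (auto simp: e_def[abs_def])
  also have "(\<lambda>j. LINT w|lborel. e j w * F w * of_real (gauss_weight w))
      = (\<lambda>j. (deriv ^^ j) ((deriv ^^ n) F) 0 / fact j * (\<zeta> - 0) ^ j)"
  proof
    fix j
    have "(LINT w|lborel. e j w * F w * of_real (gauss_weight w))
        = (LINT w|lborel. \<zeta> ^ j / fact j * (cnj w ^ (j + n) * F w * of_real (gauss_weight w)))"
      by (simp add: e_def power_add power_mult_distrib mult_ac)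
    also have "\<dots> = \<zeta> ^ j / fact j * (deriv ^^ (j + n)) F 0"
      by (simp only: integral_mult_right_zero segal_bargmann_moment[OF F])
    finally show "(LINT w|lborel. e j w * F w * of_real (gauss_weight w))
        = (deriv ^^ j) ((deriv ^^ n) F) 0 / fact j * (\<zeta> - 0) ^ j"
      by (simp add: funpow_add)
  qed
  finally have "(\<lambda>j. (deriv ^^ j) ((deriv ^^ n) F) 0 / fact j * (\<zeta> - 0) ^ j) sums
      (LINT w|lborel. cnj w ^ n * exp (\<zeta> * cnj w) * F w * of_real (gauss_weight w))" .
  moreover have "(\<lambda>j. (deriv ^^ j) ((deriv ^^ n) F) 0 / fact j * (\<zeta> - 0) ^ j) sums (deriv ^^ n) F \<zeta>"
    by (rule holomorphic_power_series[of _ 0 "cmod \<zeta> + 1"])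
      (auto intro: holomorphic_higher_deriv holomorphic_on_subset[OF hol])
  ultimately show ?thesis
    by (rule sums_unique2)
qed

text \<open>The k-th term of the expanded quadratic exponential carries (cnj w)^(2k), which the
  reproducing formula turns into the derivative of order 2k at \<zeta>. The condition |\<tau>| < 1
  is exactly the growth condition with a = |\<tau>|.\<close>

lemma heat_term_sums_integral:
  assumes F: "F \<in> segal_bargmann" and \<tau>: "cmod \<tau> < 1"
  shows "integrable lborel (\<lambda>w. exp (- (\<tau> / 2) * (cnj w)\<^sup>2 + \<zeta> * cnj w) * F w * of_real (gauss_weight w))"
    and "heat_term \<tau> F \<zeta> sums
      (LINT w|lborel. exp (- (\<tau> / 2) * (cnj w)\<^sup>2 + \<zeta> * cnj w) * F w * of_real (gauss_weight w))"
proof -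
  define e where "e k w = (- (\<tau> / 2) * (cnj w)\<^sup>2) ^ k / fact k * exp (\<zeta> * cnj w)" for k w
  have meas: "e k \<in> borel_measurable borel" for k
    unfolding e_def[abs_def] by measurable
  have bound: "(\<Sum>k<N. cmod (e k w)) \<le> 1 * exp (cmod \<tau> / 2 * (cmod w)\<^sup>2 + cmod \<zeta> * cmod w)" for N w
  proof -
    have "(\<Sum>k<N. cmod (e k w)) = (\<Sum>k<N. (cmod \<tau> / 2 * (cmod w)\<^sup>2) ^ k / fact k) * cmod (exp (\<zeta> * cnj w))"
      by (simp add: e_def norm_mult norm_power norm_divide sum_distrib_right)
    also have "\<dots> \<le> exp (cmod \<tau> / 2 * (cmod w)\<^sup>2) * exp (cmod \<zeta> * cmod w)"
      using norm_exp[of "\<zeta> * cnj w"]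
      by (intro mult_mono exp_partial_sum_le sum_nonneg) (auto simp: norm_mult)
    finally show ?thesis
      by (simp add: exp_add)
  qed
  have sums: "(\<lambda>k. e k w) sums exp (- (\<tau> / 2) * (cnj w)\<^sup>2 + \<zeta> * cnj w)" for w
    unfolding e_def exp_add by (rule sums_mult2[OF exp_sums])
  note S = segal_bargmann_integral_sums[OF F \<tau> meas bound sums]
  show "integrable lborel (\<lambda>w. exp (- (\<tau> / 2) * (cnj w)\<^sup>2 + \<zeta> * cnj w) * F w * of_real (gauss_weight w))"
    by (rule S(1))
  have "(LINT w|lborel. e k w * F w * of_real (gauss_weight w)) = heat_term \<tau> F \<zeta> k" for k
  proof -
    have "e k w * F w * of_real (gauss_weight w) = 1 / fact k * (- \<tau> / 2) ^ k *
        (cnj w ^ (2 * k) * exp (\<zeta> * cnj w) * F w * of_real (gauss_weight w))" for w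
    proof -
      have "(- (\<tau> / 2) * (cnj w)\<^sup>2) ^ k = (- \<tau> / 2) ^ k * cnj w ^ (2 * k)"
        by (simp only: power_mult power_mult_distrib minus_divide_left)
      then show ?thesis
        unfolding e_def by (simp only: mult_ac times_divide_eq_left times_divide_eq_right mult_1_left)
    qed
    then show ?thesis
      by (simp only: integral_mult_right_zero segal_bargmann_reproducing[OF F] heat_term_def)
  qed
  with S(2) show "heat_term \<tau> F \<zeta> sums
      (LINT w|lborel. exp (- (\<tau> / 2) * (cnj w)\<^sup>2 + \<zeta> * cnj w) * F w * of_real (gauss_weight w))"
    by simp
qed

subsection \<open>Metaplectic operators\<close>

text \<open>The factor in z^2 leaves the integral; what remains is the heat integral with \<tau> =
  q/p and \<zeta> = z/p.\<close>

lemma metaplectic_integral_eq_heat_op: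
  fixes A :: "real^2^2"
  assumes F: "F \<in> segal_bargmann" and pq: "cmod (q_coeff A / p_coeff A) < 1"
  shows "integrable lborel (metaplectic_integrand A F z)"
    and "(LINT w|lborel. metaplectic_integrand A F z w)
      = exp (cnj (q_coeff A) / p_coeff A * z\<^sup>2 / 2) * heat_op (q_coeff A / p_coeff A) F (z / p_coeff A)"
proof -
  define \<tau> where "\<tau> = q_coeff A / p_coeff A"
  define c where "c = exp (cnj (q_coeff A) / p_coeff A * z\<^sup>2 / 2)"
  note H = heat_term_sums_integral[OF F pq, folded \<tau>_def]
  have eq: "metaplectic_integrand A F z = (\<lambda>w. c * (exp (- (\<tau> / 2) * (cnj w)\<^sup>2 + z / p_coeff A * cnj w) *
      F w * of_real (gauss_weight w)))"
  proof
    fix w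
    have "exp (1 / 2 * (cnj (q_coeff A) / p_coeff A) * z\<^sup>2 - 1 / 2 * (q_coeff A / p_coeff A) * (cnj w)\<^sup>2
          + 1 / p_coeff A * z * cnj w)
        = c * exp (- (\<tau> / 2) * (cnj w)\<^sup>2 + z / p_coeff A * cnj w)"
      unfolding c_def \<tau>_def exp_add[symmetric]
      by (rule arg_cong[of _ _ exp]) (simp add: mult.commute)
    then show "metaplectic_integrand A F z w = c * (exp (- (\<tau> / 2) * (cnj w)\<^sup>2 + z / p_coeff A * cnj w) *
        F w * of_real (gauss_weight w))"
      unfolding metaplectic_integrand_def gauss_weight_def by (simp only: mult.assoc)
  qed
  show "integrable lborel (metaplectic_integrand A F z)"
    unfolding eq by (intro integrable_mult_right H(1))
  show "(LINT w|lborel. metaplectic_integrand A F z w)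
      = exp (cnj (q_coeff A) / p_coeff A * z\<^sup>2 / 2) * heat_op (q_coeff A / p_coeff A) F (z / p_coeff A)"
    unfolding eq integral_mult_right_zero sums_unique[OF H(2)]
    by (simp add: heat_op_def c_def \<tau>_def)
qed

text \<open>Since 0^0 = 1, exactly the term k = 0 survives.\<close>

lemma heat_op_0: "heat_op 0 F z = F z"
proof -
  have "heat_term 0 F z = (\<lambda>k. if k = 0 then F z else 0)"
    by (auto simp: heat_term_def)
  then show ?thesis
    using sums_single[of 0 "\<lambda>_. F z"] by (simp add: heat_op_def sums_iff)
qed

section \<open>The matrices attached to points of the disc\<close>

lemma one_minus_cmod_square_pos: "cmod \<tau> < 1 \<Longrightarrow> 0 < 1 - (cmod \<tau>)\<^sup>2"
  by (simp add: power_less_one_iff)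

lemma A_disc_nth:
  "A_disc \<tau> $ 1 $ 1 = (1 + Re \<tau>) / sqrt (1 - (cmod \<tau>)\<^sup>2)"
  "A_disc \<tau> $ 1 $ 2 = Im \<tau> / sqrt (1 - (cmod \<tau>)\<^sup>2)"
  "A_disc \<tau> $ 2 $ 1 = Im \<tau> / sqrt (1 - (cmod \<tau>)\<^sup>2)"
  "A_disc \<tau> $ 2 $ 2 = (1 - Re \<tau>) / sqrt (1 - (cmod \<tau>)\<^sup>2)"
  by (simp_all add: A_disc_def)

lemma A_disc_in_SL2R:
  assumes "cmod \<tau> < 1"
  shows "A_disc \<tau> \<in> SL2R"
proof -
  define s where "s = sqrt (1 - (cmod \<tau>)\<^sup>2)"
  have s: "s\<^sup>2 = 1 - (cmod \<tau>)\<^sup>2" "s \<noteq> 0"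
    using one_minus_cmod_square_pos[OF assms] by (simp_all add: s_def)
  have "det (A_disc \<tau>) = (1 + Re \<tau>) / s * ((1 - Re \<tau>) / s) - Im \<tau> / s * (Im \<tau> / s)"
    by (simp only: det_2 A_disc_nth s_def)
  also have "\<dots> = ((1 + Re \<tau>) * (1 - Re \<tau>) - Im \<tau> * Im \<tau>) / s\<^sup>2"
    by (simp only: times_divide_times_eq power2_eq_square diff_divide_distrib[symmetric])
  also have "(1 + Re \<tau>) * (1 - Re \<tau>) - Im \<tau> * Im \<tau> = s\<^sup>2"
    unfolding s cmod_power2 by (simp add: power2_eq_square algebra_simps)
  finally show ?thesis
    using s(2) by (simp add: SL2R_def)
qed

lemma A_disc_mult_vec:
  "A_disc \<tau> *v vec_of_complex z =
     vec_of_complex (z / of_real (sqrt (1 - (cmod \<tau>)\<^sup>2))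
       + \<tau> / of_real (sqrt (1 - (cmod \<tau>)\<^sup>2)) * cnj z)"
  by (simp add: vec_eq_iff forall_2 matrix_vector_mult_def sum_2 A_disc_nth vec_of_complex_def
      Re_divide_of_real Im_divide_of_real add_divide_distrib diff_divide_distrib algebra_simps)

lemma p_coeff_A_disc: "p_coeff (A_disc \<tau>) = 1 / of_real (sqrt (1 - (cmod \<tau>)\<^sup>2))"
  by (simp add: p_coeff_def A_disc_nth add_divide_distrib diff_divide_distrib flip: of_real_add of_real_diff)

lemma q_coeff_A_disc: "q_coeff (A_disc \<tau>) = \<tau> / of_real (sqrt (1 - (cmod \<tau>)\<^sup>2))"
  by (simp add: q_coeff_def A_disc_nth complex_eq_iff add_divide_distrib diff_divide_distrib)

lemma A_disc_coeff_quotients: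
  assumes "cmod \<tau> < 1"
  shows "q_coeff (A_disc \<tau>) / p_coeff (A_disc \<tau>) = \<tau>"
    and "cnj (q_coeff (A_disc \<tau>)) / p_coeff (A_disc \<tau>) = cnj \<tau>"
    and "z / p_coeff (A_disc \<tau>) = z * of_real (sqrt (1 - (cmod \<tau>)\<^sup>2))"
  using one_minus_cmod_square_pos[OF assms]
  by (simp_all add: p_coeff_A_disc q_coeff_A_disc)

lemma V_disc_in_metaplectic:
  assumes \<tau>: "cmod \<tau> < 1"
  shows "V_disc \<tau> \<in> metaplectic (A_disc \<tau>)"
proof -
  define d where "d = 1 - (cmod \<tau>)\<^sup>2"
  \<comment> \<open>The positive square root of p = d^(-1/2). It fixes the sign of V(A), since 1/s
    is then the prefactor d^(1/4) of \<open>V_disc\<close>.\<close>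
  define s :: complex where "s = of_real (d powr - (1/4))"
  have d: "d > 0"
    using one_minus_cmod_square_pos[OF \<tau>] by (simp add: d_def)
  have "(d powr - (1/4))\<^sup>2 = 1 / sqrt d"
    using d by (simp add: power2_eq_square powr_add[symmetric] powr_minus_divide powr_half_sqrt)
  then have s2: "s\<^sup>2 = p_coeff (A_disc \<tau>)"
    unfolding s_def p_coeff_A_disc d_def[symmetric] by (metis of_real_1 of_real_divide of_real_power)
  have s1: "1 / s = of_real (d powr (1/4))"
    using d by (simp add: s_def powr_minus_divide)
  have "V_disc \<tau> = (\<lambda>f\<in>segal_bargmann. \<lambda>z. 1 / s * (LINT w|lborel. metaplectic_integrand (A_disc \<tau>) f z w))"
    unfolding V_disc_def
  proof (rule restrict_ext)
    fix F assume F: "F \<in> segal_bargmann"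
    have M: "(LINT w|lborel. metaplectic_integrand (A_disc \<tau>) F z w)
        = exp (cnj \<tau> * z\<^sup>2 / 2) * heat_op \<tau> F (z * of_real (sqrt (1 - (cmod \<tau>)\<^sup>2)))" for z
      using metaplectic_integral_eq_heat_op(2)[OF F, of "A_disc \<tau>" z] \<tau>
      unfolding A_disc_coeff_quotients(1,2)[OF \<tau>] unfolding A_disc_coeff_quotients(3)[OF \<tau>] by blast
    show "(\<lambda>z. of_real ((1 - (cmod \<tau>)\<^sup>2) powr (1/4)) * exp (cnj \<tau> * z\<^sup>2 / 2) *
        heat_op \<tau> F (z * of_real (sqrt (1 - (cmod \<tau>)\<^sup>2)))) =
      (\<lambda>z. 1 / s * (LINT w|lborel. metaplectic_integrand (A_disc \<tau>) F z w))"
      unfolding M s1 d_def by (simp only: mult.assoc)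
  qed
  with s2 show ?thesis
    unfolding metaplectic_def by blast
qed

section \<open>Rotations\<close>

lemma rotation2_in_SL2R: "rotation2 \<theta> \<in> SL2R"
  by (simp add: SL2R_def rotation2_def det_2 flip: power2_eq_square)

lemma p_coeff_rotation2: "p_coeff (rotation2 \<theta>) = exp (\<i> * of_real \<theta>)"
  by (simp add: p_coeff_def rotation2_def complex_eq_iff cis_conv_exp[symmetric])

lemma q_coeff_rotation2: "q_coeff (rotation2 \<theta>) = 0"
  by (simp add: q_coeff_def rotation2_def)

text \<open>With q = 0 the Gaussian prefactor is 1 and the heat operator is the identity, leaving F
  evaluated at z/p.\<close>

lemma integral_metaplectic_rotation2:
  assumes "F \<in> segal_bargmann"
  shows "(LINT w|lborel. metaplectic_integrand (rotation2 \<theta>) F z w) = F (exp (- \<i> * of_real \<theta>) * z)"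
proof -
  have "z / p_coeff (rotation2 \<theta>) = exp (- \<i> * of_real \<theta>) * z"
    unfolding p_coeff_rotation2 by (simp add: exp_minus field_simps)
  with metaplectic_integral_eq_heat_op(2)[OF assms, of "rotation2 \<theta>" z] show ?thesis
    by (simp add: q_coeff_rotation2 heat_op_0)
qed

lemma metaplectic_rotation2:
  "metaplectic (rotation2 \<theta>) =
     {\<lambda>F\<in>segal_bargmann. \<lambda>z.
        \<epsilon> * exp (- \<i> * of_real \<theta> / 2) * F (exp (- \<i> * of_real \<theta>) * z) | \<epsilon>. \<epsilon> \<in> {1, -1}}"
  (is "_ = ?R")
proof -
  \<comment> \<open>One square root of p; the other is -r. As each sign is its own inverse, the
    factor 1/s runs through both signs times exp(-\<i>\<theta>/2).\<close>
  define r where "r = exp (\<i> * of_real \<theta> / 2)"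
  have r2: "r\<^sup>2 = exp (\<i> * of_real \<theta>)"
    by (simp add: r_def exp_double[symmetric])
  have inv: "1 / (\<epsilon> * r) = \<epsilon> * exp (- \<i> * of_real \<theta> / 2)" if "\<epsilon> \<in> {1, -1}" for \<epsilon>
  proof -
    have "r * exp (- \<i> * of_real \<theta> / 2) = 1"
      by (simp add: r_def exp_add[symmetric])
    then have "exp (- \<i> * of_real \<theta> / 2) = 1 / r"
      by (metis divide_eq_eq mult.commute mult_zero_left zero_neq_one)
    then show ?thesis using that by auto
  qed
  have roots: "s\<^sup>2 = p_coeff (rotation2 \<theta>) \<longleftrightarrow> (\<exists>\<epsilon>\<in>{1, -1}. s = \<epsilon> * r)" for s
    unfolding p_coeff_rotation2 r2[symmetric] by (auto simp: power2_eq_iff)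
  have "metaplectic (rotation2 \<theta>) =
      {\<lambda>f\<in>segal_bargmann. \<lambda>z. 1 / s * f (exp (- \<i> * of_real \<theta>) * z) | s. s\<^sup>2 = p_coeff (rotation2 \<theta>)}"
    unfolding metaplectic_def
    by (simp add: integral_metaplectic_rotation2 cong: restrict_cong)
  also have "\<dots> = {\<lambda>f\<in>segal_bargmann. \<lambda>z. 1 / (\<epsilon> * r) * f (exp (- \<i> * of_real \<theta>) * z) | \<epsilon>. \<epsilon> \<in> {1, -1}}"
    unfolding roots by blast
  also have "\<dots> = ?R"
    by (intro Collect_cong ex_cong1 rev_conj_cong refl) (simp only: inv)
  finally show ?thesis .
qed

theorem proposition1p4:
  shows "(\<forall>\<tau>. cmod \<tau> < 1 \<longrightarrow>
            A_disc \<tau> \<in> SL2R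
          \<and> (\<forall>z. A_disc \<tau> *v vec_of_complex z =
                  vec_of_complex (z / of_real (sqrt (1 - (cmod \<tau>)\<^sup>2))
                                  + \<tau> / of_real (sqrt (1 - (cmod \<tau>)\<^sup>2)) * cnj z))
          \<and> (\<forall>F\<in>segal_bargmann. \<forall>z. summable (heat_term \<tau> F z))
          \<and> (\<forall>F\<in>segal_bargmann. \<forall>z. integrable lborel (metaplectic_integrand (A_disc \<tau>) F z))
          \<and> V_disc \<tau> \<in> metaplectic (A_disc \<tau>))
       \<and> (\<forall>\<theta>::real.
            rotation2 \<theta> \<in> SL2R
          \<and> (\<forall>F\<in>segal_bargmann. \<forall>z. integrable lborel (metaplectic_integrand (rotation2 \<theta>) F z))
          \<and> metaplectic (rotation2 \<theta>) =
              {\<lambda>F\<in>segal_bargmann. \<lambda>z.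
                 \<epsilon> * exp (- \<i> * of_real \<theta> / 2) * F (exp (- \<i> * of_real \<theta>) * z) | \<epsilon>.
               \<epsilon> \<in> {1, -1}})"
proof (intro conjI allI impI ballI)
  fix \<tau> F z assume \<tau>: "cmod \<tau> < 1" and F: "F \<in> segal_bargmann"
  show "summable (heat_term \<tau> F z)"
    using sums_summable heat_term_sums_integral(2)[OF F \<tau>] by blast
  show "integrable lborel (metaplectic_integrand (A_disc \<tau>) F z)"
    by (rule metaplectic_integral_eq_heat_op(1)[OF F]) (simp only: A_disc_coeff_quotients(1)[OF \<tau>] \<tau>)
next
  fix \<theta> F z assume "F \<in> segal_bargmann"
  then show "integrable lborel (metaplectic_integrand (rotation2 \<theta>) F z)"
    by (rule metaplectic_integral_eq_heat_op(1)) (simp add: q_coeff_rotation2)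
qed (rule A_disc_in_SL2R A_disc_mult_vec V_disc_in_metaplectic rotation2_in_SL2R metaplectic_rotation2;
    assumption?)+

end
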